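(* Let $(X,\mathcal{S})$ be an $S$-metric space and let $(X,d^S)$ be the $b$-metric space with $d^S(x,y)=\mathcal{S}(x,x,y)$. Let $f:X\to X$ be a self-mapping, let $0\le a<1$ be a fixed number, and let $\mu=\inf\{d^S(x,fx): x\neq fx,\ x\in X\}$. Suppose there exist a simulation function $\zeta\in\mathcal{Z}$ and a point $x_0\in X$ such that (i) for all $x\in C_{x_0,\mu}^{d^S}$ there exists a $\delta(\mu)>0$ satisfying $$\frac{\mu}{4}\le M_{d^S}(x,x_0)<\frac{\mu}{4}+\delta(\mu)\ \Longrightarrow\ d^S(fx,x_0)\le\mu,$$ where $C_{x_0,\mu}^{d^S}=\{x\in X: d^S(x,x_0)=\mu\}$ and $$M_{d^S}(x,x_0)=\max\left\{a\,d^S(x,fx)+(1-a)\,d^S(x_0,fx_0),\ (1-a)\,d^S(x,fx)+a\,d^S(x_0,fx_0),\ \frac{d^S(x,fx_0)+d^S(x_0,fx)}{4}\right\};$$ (ii) for all $x\in X$, $$d^S(fx,x)>0\ \Longrightarrow\ \zeta\big(d^S(fx,x),M_{d^S}(x,x_0)\big)\ge 0.$$ Then $x_0\in Fix(f)$ and the circle $C_{x_0,\mu}^{d^S}$ is a fixed circle of $f$, that is, $fx=x$ for all $x\in C_{x_0,\mu}^{d^S}$.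
   Context: An $S$-metric on a nonempty set $X$ is a function $\mathcal{S}:X^3\to[0,\infty)$ such that for all $x,y,z,a\in X$: (1) $\mathcal{S}(x,y,z)=0$ if and only if $x=y=z$; (2) $\mathcal{S}(x,y,z)\le\mathcal{S}(x,x,a)+\mathcal{S}(y,y,a)+\mathcal{S}(z,z,a)$. The function $d^S(x,y)=\mathcal{S}(x,x,y)$ is then a $b$-metric on $X$ with $b=\frac32$. $\mathcal{Z}$ is the set of simulation functions: functions $\zeta:[0,\infty)\times[0,\infty)\to\mathbb{R}$ such that ($\zeta_1$) $\zeta(0,0)=0$; ($\zeta_2$) $\zeta(t,s)<s-t$ for all $s,t>0$; ($\zeta_3$) if $\{t_n\},\{s_n\}$ are sequences in $(0,\infty)$ with $\lim_{n\to\infty}t_n=\lim_{n\to\infty}s_n>0$, then $\limsup_{n\to\infty}\zeta(t_n,s_n)<0$. Write $fx=f(x)$ and $Fix(f)=\{x\in X: fx=x\}$. *)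

theory Defs
  imports Complex_Main "HOL-Library.Extended_Real" "HOL-Library.Liminf_Limsup" "HOL-Library.FuncSet"
begin

definition S_metric_on :: "'a set \<Rightarrow> ('a \<Rightarrow> 'a \<Rightarrow> 'a \<Rightarrow> real) \<Rightarrow> bool" where
  "S_metric_on X S \<longleftrightarrow>
     X \<noteq> {} \<and>
     (\<forall>x\<in>X. \<forall>y\<in>X. \<forall>z\<in>X. 0 \<le> S x y z) \<and>
     (\<forall>x\<in>X. \<forall>y\<in>X. \<forall>z\<in>X. S x y z = 0 \<longleftrightarrow> x = y \<and> y = z) \<and>
     (\<forall>x\<in>X. \<forall>y\<in>X. \<forall>z\<in>X. \<forall>a\<in>X. S x y z \<le> S x x a + S y y a + S z z a)"

definition b_metric_on :: "'a set \<Rightarrow> real \<Rightarrow> ('a \<Rightarrow> 'a \<Rightarrow> real) \<Rightarrow> bool" where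
  "b_metric_on X b d \<longleftrightarrow>
     X \<noteq> {} \<and> 1 \<le> b \<and>
     (\<forall>x\<in>X. \<forall>y\<in>X. 0 \<le> d x y) \<and>
     (\<forall>x\<in>X. \<forall>y\<in>X. d x y = 0 \<longleftrightarrow> x = y) \<and>
     (\<forall>x\<in>X. \<forall>y\<in>X. d x y = d y x) \<and>
     (\<forall>x\<in>X. \<forall>y\<in>X. \<forall>z\<in>X. d x z \<le> b * (d x y + d y z))"

definition S_dist :: "('a \<Rightarrow> 'a \<Rightarrow> 'a \<Rightarrow> real) \<Rightarrow> 'a \<Rightarrow> 'a \<Rightarrow> real" where
  "S_dist S x y = S x x y"

lemma b_metric_on_S_dist:
  assumes "S_metric_on X S"
  shows "b_metric_on X (3/2) (S_dist S)"
proof -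
  have zero: "S x y z = 0 \<longleftrightarrow> x = y \<and> y = z" if "x \<in> X" "y \<in> X" "z \<in> X" for x y z
    using assms that unfolding S_metric_on_def by blast
  have tri: "S x y z \<le> S x x a + S y y a + S z z a"
    if "x \<in> X" "y \<in> X" "z \<in> X" "a \<in> X" for x y z a
    using assms that unfolding S_metric_on_def by blast
  have le: "S x x y \<le> S y y x" if "x \<in> X" "y \<in> X" for x y
    using tri[of x x y x] zero[of x x x] that by simp
  have sym: "S x x y = S y y x" if "x \<in> X" "y \<in> X" for x y
    using le that by (simp add: order_antisym)
  have "S x x z \<le> 3/2 * (S x x y + S y y z)" if "x \<in> X" "y \<in> X" "z \<in> X" for x y z
    using tri[of x x z y] tri[of z z x y] sym[of x z] sym[of y z] that by simp
  then show ?thesis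
    using assms zero sym unfolding b_metric_on_def S_dist_def S_metric_on_def by auto
qed

text \<open>Simulation functions are defined on \<open>[0,\<infinity>) \<times> [0,\<infinity>)\<close>; values of \<open>\<zeta>\<close> at negative
  arguments are unconstrained.  The upper limit is taken in the extended reals, since
  \<open>\<zeta> (t n) (s n)\<close> need not be bounded below.\<close>

definition simulation_function :: "(real \<Rightarrow> real \<Rightarrow> real) \<Rightarrow> bool" where
  "simulation_function \<zeta> \<longleftrightarrow>
     \<zeta> 0 0 = 0 \<and>
     (\<forall>t>0. \<forall>s>0. \<zeta> t s < s - t) \<and>
     (\<forall>t s L. (\<forall>n. 0 < t n) \<longrightarrow> (\<forall>n. 0 < s n) \<longrightarrow> 0 < L \<longrightarrow>
        t \<longlonglongrightarrow> L \<longrightarrow> s \<longlonglongrightarrow> L \<longrightarrow>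
        limsup (\<lambda>n. ereal (\<zeta> (t n) (s n))) < 0)"

definition Fix_on :: "'a set \<Rightarrow> ('a \<Rightarrow> 'a) \<Rightarrow> 'a set" where
  "Fix_on X f = {x \<in> X. f x = x}"

definition circle_on :: "'a set \<Rightarrow> ('a \<Rightarrow> 'a \<Rightarrow> real) \<Rightarrow> 'a \<Rightarrow> real \<Rightarrow> 'a set" where
  "circle_on X d x0 r = {x \<in> X. d x x0 = r}"

text \<open>If \<open>f\<close> is the identity on \<open>X\<close>, the infimum is over the empty set, where \<open>Inf\<close> on
  \<open>real\<close> has no mathematical meaning; every point of \<open>X\<close> is then fixed.\<close>

definition displacement_inf :: "'a set \<Rightarrow> ('a \<Rightarrow> 'a \<Rightarrow> real) \<Rightarrow> ('a \<Rightarrow> 'a) \<Rightarrow> real" where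
  "displacement_inf X d f = Inf {d x (f x) | x. x \<in> X \<and> x \<noteq> f x}"

definition M_max :: "('a \<Rightarrow> 'a \<Rightarrow> real) \<Rightarrow> ('a \<Rightarrow> 'a) \<Rightarrow> real \<Rightarrow> 'a \<Rightarrow> 'a \<Rightarrow> real" where
  "M_max d f a x y =
     Max {a * d x (f x) + (1 - a) * d y (f y),
          (1 - a) * d x (f x) + a * d y (f y),
          (d x (f y) + d y (f x)) / 4}"

end

theory Submission
  imports Defs
begin

text \<open>The simulation condition forces \<open>d (f x) x < M(x, x0)\<close> whenever \<open>x\<close> is moved. For \<open>x = x0\<close>
  the two sides coincide, so \<open>x0\<close> is fixed. For a moved \<open>x\<close> on the circle, with displacement
  \<open>D \<ge> \<mu>\<close>, the first two entries of \<open>M\<close> are at most \<open>D\<close>, and so is the third, because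
  \<open>d x0 (f x) \<le> 3/2 * (\<mu> + D)\<close> bounds it by \<open>(5 * \<mu> + 3 * D) / 8\<close>.\<close>

lemma simulation_function_less:
  assumes "simulation_function \<zeta>" "0 < t" "0 < s" "0 \<le> \<zeta> t s"
  shows "t < s"
  using assms unfolding simulation_function_def by force

text \<open>Nonnegativity of \<open>d\<close> on displacements supplies the lower bound 0, and the
  moved point \<open>x\<close> makes the set nonempty, so \<open>Inf\<close> is a genuine infimum
  here.\<close>

lemma displacement_inf_le:
  assumes "\<And>y. y \<in> X \<Longrightarrow> 0 \<le> d y (f y)" "x \<in> X" "x \<noteq> f x"
  shows "displacement_inf X d f \<le> d x (f x)"
  unfolding displacement_inf_def
  by (rule cInf_lower) (use assms in \<open>auto intro!: bdd_belowI[of _ 0]\<close>)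

theorem theorem2p12:
  fixes X :: "'a set" and S :: "'a \<Rightarrow> 'a \<Rightarrow> 'a \<Rightarrow> real" and d :: "'a \<Rightarrow> 'a \<Rightarrow> real"
    and f :: "'a \<Rightarrow> 'a" and a \<mu> :: real and \<zeta> :: "real \<Rightarrow> real \<Rightarrow> real" and x0 :: 'a
  assumes "S_metric_on X S"
    and "d = S_dist S"
    and "f \<in> X \<rightarrow> X"
    and "0 \<le> a" and "a < 1"
    and "\<mu> = displacement_inf X d f"
    and "simulation_function \<zeta>"
    and "x0 \<in> X"
    and "\<forall>x \<in> circle_on X d x0 \<mu>. \<exists>\<delta>>0.
           \<mu> / 4 \<le> M_max d f a x x0 \<and> M_max d f a x x0 < \<mu> / 4 + \<delta> \<longrightarrow> d (f x) x0 \<le> \<mu>"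
    and "\<forall>x \<in> X. d (f x) x > 0 \<longrightarrow> \<zeta> (d (f x) x) (M_max d f a x x0) \<ge> 0"
  shows "x0 \<in> Fix_on X f \<and> (\<forall>x \<in> circle_on X d x0 \<mu>. f x = x)"
proof -
  have S: "S_metric_on X S" and x0: "x0 \<in> X" by fact+
  have fX: "f x \<in> X" if "x \<in> X" for x
    using assms(3) that by blast
  have b_metric: "b_metric_on X (3/2) d"
    using b_metric_on_S_dist[OF S] assms(2) by simp
  have nonneg: "0 \<le> d x y" and eq_0: "d x y = 0 \<longleftrightarrow> x = y" and commute: "d x y = d y x"
    if "x \<in> X" "y \<in> X" for x y
    using b_metric that unfolding b_metric_on_def by blast+
  have triangle: "d x z \<le> 3/2 * (d x y + d y z)" if "x \<in> X" "y \<in> X" "z \<in> X" for x y z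
    using b_metric that unfolding b_metric_on_def by blast
  \<comment> \<open>Positivity of \<open>M_max\<close> is a premise because the bound \<zeta> t s <
    s - t is only given for positive arguments.\<close>
  have less_M: "d x (f x) < M_max d f a x x0"
    if "x \<in> X" "f x \<noteq> x" "0 < M_max d f a x x0" for x
  proof -
    have "0 < d (f x) x"
      using eq_0[of "f x" x] nonneg[of "f x" x] fX that by force
    then have "d (f x) x < M_max d f a x x0"
      using simulation_function_less[OF assms(7)] assms(10) that by blast
    then show ?thesis
      using commute fX that by simp
  qed
  have fix0: "f x0 = x0"
  proof (rule ccontr)
    assume neq: "f x0 \<noteq> x0"
    have pos: "0 < d x0 (f x0)"
      using eq_0[of x0 "f x0"] nonneg[of x0 "f x0"] fX x0 neq by force
    \<comment> \<open>The weights a and 1 - a sum to 1, so the first two entries equal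
      \<open>d x0 (f x0)\<close>; the third is half of it.\<close>
    have "M_max d f a x0 x0 = d x0 (f x0)"
      using pos by (simp add: M_max_def algebra_simps)
    with less_M[OF x0 neq] pos show False
      by simp
  qed
  have "f x = x" if circ: "x \<in> circle_on X d x0 \<mu>" for x
  proof (rule ccontr)
    assume neq: "f x \<noteq> x"
    have x: "x \<in> X" and dx: "d x x0 = \<mu>"
      using circ by (auto simp: circle_on_def)
    define D where "D = d x (f x)"
    have "x \<noteq> x0"
      using neq fix0 by blast
    then have \<mu>: "0 < \<mu>"
      using eq_0[of x x0] nonneg[of x x0] x x0 dx by force
    have le: "\<mu> \<le> D"
      unfolding assms(6) D_def using displacement_inf_le nonneg fX x neq by metis
    have tri: "d x0 (f x) \<le> 3/2 * (\<mu> + D)"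
      using triangle[of x0 x "f x"] commute[of x x0] fX x x0 dx by (simp add: D_def)
    \<comment> \<open>As \<open>x0\<close> is fixed, its own displacement vanishes and
      \<open>d x (f x0)\<close> is the radius \<mu>.\<close>
    have M: "M_max d f a x x0 = Max {a * D, (1 - a) * D, (\<mu> + d x0 (f x)) / 4}"
      using fix0 eq_0[of x0 x0] x0 dx by (simp add: M_max_def D_def)
    have "0 < (\<mu> + d x0 (f x)) / 4"
      using \<mu> nonneg fX x x0 by (simp add: add_pos_nonneg)
    then have "0 < M_max d f a x x0"
      unfolding M by (simp add: less_max_iff_disj)
    then have "D < M_max d f a x x0"
      using less_M x neq D_def by blast
    moreover have "a * D \<le> D" "(1 - a) * D \<le> D"
      using assms(4,5) \<mu> le by (simp_all add: mult_left_le_one_le)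
    \<comment> \<open>By \<mu> \<le> D the third entry is at most (1 + 2b) * D / 4 with b = 3/2,
      which is exactly D: the divisor 4 leaves no slack.\<close>
    then have "M_max d f a x x0 \<le> D"
      unfolding M using tri le by simp
    ultimately show False
      by simp
  qed
  with fix0 x0 show ?thesis
    by (simp add: Fix_on_def)
qed

end
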